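(* The maximum size of a set of mutually orthogoval affine planes of order $3$ (each isomorphic to $\mathrm{AG}(2,3)$), all on a common point set, is seven.
   Context: Two planes, both projective or both affine, of the same order and on the same point set are called orthogoval if every line of one plane intersects every line of the other plane in at most two points. A set of planes is a set of mutually orthogoval planes if the planes are pairwise orthogoval. *)

theory Defs
  imports "HOL-Library.Numeral_Type"
begin

text \<open>A plane is a pair consisting of its point set and its set of lines, a line being
  a set of points.\<close>

type_synonym 'a plane = "'a set \<times> 'a set set"

abbreviation points :: "'a plane \<Rightarrow> 'a set" where "points \<equiv> fst"
abbreviation lines :: "'a plane \<Rightarrow> 'a set set" where "lines \<equiv> snd"

definition collinear_in :: "'a plane \<Rightarrow> 'a set \<Rightarrow> bool" where
  "collinear_in \<pi> X \<longleftrightarrow> (\<exists>l\<in>lines \<pi>. X \<subseteq> l)"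

definition linear_space :: "'a plane \<Rightarrow> bool" where
  "linear_space \<pi> \<longleftrightarrow>
     (\<forall>l\<in>lines \<pi>. l \<subseteq> points \<pi>) \<and>
     (\<forall>p\<in>points \<pi>. \<forall>q\<in>points \<pi>. p \<noteq> q \<longrightarrow> (\<exists>!l. l \<in> lines \<pi> \<and> p \<in> l \<and> q \<in> l))"

definition affine_plane :: "'a plane \<Rightarrow> bool" where
  "affine_plane \<pi> \<longleftrightarrow>
     linear_space \<pi> \<and>
     (\<forall>l\<in>lines \<pi>. \<forall>p\<in>points \<pi>. p \<notin> l \<longrightarrow> (\<exists>!m. m \<in> lines \<pi> \<and> p \<in> m \<and> l \<inter> m = {})) \<and>
     (\<exists>X\<subseteq>points \<pi>. card X = 3 \<and> \<not> collinear_in \<pi> X)"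

definition projective_plane :: "'a plane \<Rightarrow> bool" where
  "projective_plane \<pi> \<longleftrightarrow>
     linear_space \<pi> \<and>
     (\<forall>l\<in>lines \<pi>. \<forall>m\<in>lines \<pi>. l \<noteq> m \<longrightarrow> (\<exists>!p. p \<in> l \<and> p \<in> m)) \<and>
     (\<exists>Q\<subseteq>points \<pi>. card Q = 4 \<and> (\<forall>X\<subseteq>Q. card X = 3 \<longrightarrow> \<not> collinear_in \<pi> X))"

text \<open>Finiteness is required explicitly, since infinite lines would have cardinality 0.\<close>

definition affine_plane_of_order :: "nat \<Rightarrow> 'a plane \<Rightarrow> bool" where
  "affine_plane_of_order n \<pi> \<longleftrightarrow>
     affine_plane \<pi> \<and> finite (points \<pi>) \<and> (\<forall>l\<in>lines \<pi>. card l = n)"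

definition projective_plane_of_order :: "nat \<Rightarrow> 'a plane \<Rightarrow> bool" where
  "projective_plane_of_order n \<pi> \<longleftrightarrow>
     projective_plane \<pi> \<and> finite (points \<pi>) \<and> (\<forall>l\<in>lines \<pi>. card l = n + 1)"

definition orthogoval :: "'a plane \<Rightarrow> 'a plane \<Rightarrow> bool" where
  "orthogoval \<pi> \<sigma> \<longleftrightarrow>
     points \<pi> = points \<sigma> \<and>
     (\<exists>n. affine_plane_of_order n \<pi> \<and> affine_plane_of_order n \<sigma> \<or>
          projective_plane_of_order n \<pi> \<and> projective_plane_of_order n \<sigma>) \<and>
     (\<forall>l\<in>lines \<pi>. \<forall>m\<in>lines \<sigma>. card (l \<inter> m) \<le> 2)"

abbreviation mutually_orthogoval :: "'a plane set \<Rightarrow> bool" where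
  "mutually_orthogoval S \<equiv> pairwise orthogoval S"

text \<open>The common point set is an explicit parameter because pairwise orthogovality
  constrains nothing when \<open>S\<close> has at most one element.\<close>

definition mutually_orthogoval_affine_planes :: "nat \<Rightarrow> 'a set \<Rightarrow> 'a plane set \<Rightarrow> bool" where
  "mutually_orthogoval_affine_planes n P S \<longleftrightarrow>
     (\<forall>\<pi>\<in>S. affine_plane_of_order n \<pi> \<and> points \<pi> = P) \<and> mutually_orthogoval S"

definition isomorphic_planes :: "'a plane \<Rightarrow> 'b plane \<Rightarrow> bool" where
  "isomorphic_planes \<pi> \<sigma> \<longleftrightarrow>
     (\<exists>f. bij_betw f (points \<pi>) (points \<sigma>) \<and> (\<lambda>l. f ` l) ` lines \<pi> = lines \<sigma>)"

text \<open>The type \<open>3\<close> is the ring of integers modulo 3, that is, the field with three elements.\<close>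

definition AG_2_3 :: "(3 \<times> 3) plane" where
  "AG_2_3 = (UNIV, {{(x, y). a * x + b * y = c} | a b c. (a, b) \<noteq> (0, 0)})"

end

theory Submission
  imports Defs
begin

text \<open>Two parallel classes of an affine plane identify its point set with a grid. For order 3 the
  grid has 9 points, and any line outside the two classes has a point in each row and in each
  column; since its third point is determined by two of them, all six transversals of the grid
  are lines, which leaves only \<open>AG(2,3)\<close>. Such a plane has 12 lines, and orthogoval planes share
  no line, so \<open>s\<close> mutually orthogoval planes use \<open>12 s\<close> of the \<open>84\<close> triples of points.
  Conversely, there is a plane on \<open>\<int>/7\<close> with two further points whose 12 lines lie in the 12
  different orbits of triples under translation, so that its 7 translates partition the 84
  triples.\<close>

section \<open>Grids in affine planes\<close>

lemma linear_space_line_subset: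
  "linear_space \<pi> \<Longrightarrow> l \<in> lines \<pi> \<Longrightarrow> l \<subseteq> points \<pi>"
  by (simp add: linear_space_def)

lemma linear_space_line_exists:
  assumes "linear_space \<pi>" "p \<in> points \<pi>" "q \<in> points \<pi>" "p \<noteq> q"
  obtains l where "l \<in> lines \<pi>" "p \<in> l" "q \<in> l"
  using assms unfolding linear_space_def by blast

lemma linear_space_line_eq:
  assumes "linear_space \<pi>" "l \<in> lines \<pi>" "m \<in> lines \<pi>"
    and "p \<in> l" "q \<in> l" "p \<in> m" "q \<in> m" "p \<noteq> q"
  shows "l = m"
proof -
  have "p \<in> points \<pi>" "q \<in> points \<pi>"
    using assms linear_space_line_subset by blast+
  then show ?thesis
    using assms unfolding linear_space_def by blast
qed

text \<open>Equality counts as parallelism, so that on the lines of an affine plane it is an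
  equivalence relation and each point lies on exactly one parallel of a given line, whether or not
  it lies on that line.\<close>

definition parallel :: "'a set \<Rightarrow> 'a set \<Rightarrow> bool" where
  "parallel l m \<longleftrightarrow> l = m \<or> l \<inter> m = {}"

lemma parallel_sym: "parallel l m \<Longrightarrow> parallel m l"
  by (auto simp: parallel_def)

context
  fixes \<pi> :: "'a plane"
  assumes affine: "affine_plane \<pi>"
begin

lemma linear: "linear_space \<pi>"
  using affine by (simp add: affine_plane_def)

lemma parallel_line_exists:
  assumes "l \<in> lines \<pi>" "p \<in> points \<pi>"
  shows "\<exists>m. m \<in> lines \<pi> \<and> p \<in> m \<and> parallel l m"
  using assms affine unfolding affine_plane_def parallel_def by metis

lemma parallel_line_eq:
  assumes "l \<in> lines \<pi>" "m \<in> lines \<pi>" "n \<in> lines \<pi>"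
    and "parallel l m" "parallel l n" "p \<in> m" "p \<in> n"
  shows "m = n"
proof (cases "p \<in> l")
  case True
  then show ?thesis
    using assms by (auto simp: parallel_def)
next
  case False
  then have "l \<inter> m = {}" "l \<inter> n = {}"
    using assms by (auto simp: parallel_def)
  moreover have "p \<in> points \<pi>"
    using assms linear_space_line_subset[OF linear] by blast
  ultimately show ?thesis
    using assms False affine unfolding affine_plane_def by metis
qed

text \<open>If \<open>l\<close> and \<open>n\<close> share a point, both are the parallel of
  \<open>m\<close> through that point, hence equal.\<close>

lemma parallel_trans:
  assumes "l \<in> lines \<pi>" "m \<in> lines \<pi>" "n \<in> lines \<pi>" "parallel l m" "parallel m n"
  shows "parallel l n"
proof (cases "l \<inter> n = {}")
  case False
  then obtain p where "p \<in> l" "p \<in> n" by blast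
  then have "l = n"
    using assms parallel_line_eq parallel_sym by metis
  then show ?thesis by (simp add: parallel_def)
qed (simp add: parallel_def)

lemma nonparallel_lines_meet:
  assumes "l \<in> lines \<pi>" "m \<in> lines \<pi>" "\<not> parallel l m"
  shows "\<exists>!p. p \<in> l \<inter> m"
  using assms linear_space_line_eq[OF linear] unfolding parallel_def by blast

text \<open>Two sides of a noncollinear triangle share a vertex and differ.\<close>

lemma nonparallel_lines_exist:
  obtains L M where "L \<in> lines \<pi>" "M \<in> lines \<pi>" "\<not> parallel L M"
proof -
  obtain X where X: "X \<subseteq> points \<pi>" "card X = 3" "\<not> collinear_in \<pi> X"
    using affine unfolding affine_plane_def by blast
  then obtain x y z where xyz: "X = {x, y, z}" "x \<noteq> y" "x \<noteq> z"
    by (auto simp: card_3_iff)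
  obtain L where L: "L \<in> lines \<pi>" "x \<in> L" "y \<in> L"
    using linear_space_line_exists[OF linear] X xyz by (metis insert_subset)
  obtain M where M: "M \<in> lines \<pi>" "x \<in> M" "z \<in> M"
    using linear_space_line_exists[OF linear] X xyz by (metis insert_subset)
  have "L \<noteq> M"
    using X xyz L M by (auto simp: collinear_in_def)
  then show thesis
    using L M that by (auto simp: parallel_def)
qed

text \<open>The cell \<open>(a, b)\<close> is the point where the parallel of \<open>M\<close>
  through \<open>a\<close> meets the parallel of \<open>L\<close> through \<open>b\<close>. Columns
  of the grid are thus the parallel class of \<open>M\<close>, rows that of
  \<open>L\<close>.\<close>

lemma affine_plane_grid:
  assumes L: "L \<in> lines \<pi>" and M: "M \<in> lines \<pi>" and LM: "\<not> parallel L M"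
  obtains f where "bij_betw f (L \<times> M) (points \<pi>)"
    and "\<And>a. a \<in> L \<Longrightarrow> f ` ({a} \<times> M) \<in> lines \<pi>"
    and "\<And>b. b \<in> M \<Longrightarrow> f ` (L \<times> {b}) \<in> lines \<pi>"
proof -
  have in_points: "p \<in> points \<pi>" if "l \<in> lines \<pi>" "p \<in> l" for l p
    using that linear_space_line_subset[OF linear] by blast
  obtain C where C: "\<And>p. p \<in> points \<pi> \<Longrightarrow> C p \<in> lines \<pi> \<and> p \<in> C p \<and> parallel M (C p)"
    using parallel_line_exists[OF M] by metis
  obtain R where R: "\<And>p. p \<in> points \<pi> \<Longrightarrow> R p \<in> lines \<pi> \<and> p \<in> R p \<and> parallel L (R p)"
    using parallel_line_exists[OF L] by metis
  have C_eq: "C p = C q" if "p \<in> points \<pi>" "q \<in> points \<pi>" "r \<in> C p" "r \<in> C q" for p q r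
    using parallel_line_eq[OF M] C that by blast
  have R_eq: "R p = R q" if "p \<in> points \<pi>" "q \<in> points \<pi>" "r \<in> R p" "r \<in> R q" for p q r
    using parallel_line_eq[OF L] R that by blast
  \<comment> \<open>Otherwise transitivity would carry the parallelism of \<open>l\<close> and
    \<open>m\<close> over to \<open>L\<close> and \<open>M\<close>. So every column meets every row
    in one point.\<close>
  have not_par: "\<not> parallel l m" if "l \<in> lines \<pi>" "m \<in> lines \<pi>" "parallel L l" "parallel M m" for l m
    using that LM L M parallel_trans parallel_sym by meson
  have parLL: "parallel L L" and parMM: "parallel M M"
    by (simp_all add: parallel_def)
  have "\<exists>p. p \<in> C a \<inter> R b" if "a \<in> L" "b \<in> M" for a b
    using nonparallel_lines_meet not_par C R in_points L M that by (metis Int_commute)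
  then obtain g where g: "\<And>a b. a \<in> L \<Longrightarrow> b \<in> M \<Longrightarrow> g a b \<in> C a \<and> g a b \<in> R b"
    by (metis IntE)
  define f where "f = (\<lambda>(a, b). g a b)"
  \<comment> \<open>Both \<open>a\<close> and \<open>a'\<close> lie on \<open>L\<close> and on the
    common column, and these two lines meet only once.\<close>
  have C_inj: "a = a'" if "a \<in> L" "a' \<in> L" "C a = C a'" for a a'
    using nonparallel_lines_meet[OF L, of "C a"] not_par[OF L _ parLL] C in_points[OF L] that
    by (metis IntI)
  have R_inj: "b = b'" if "b \<in> M" "b' \<in> M" "R b = R b'" for b b'
    using nonparallel_lines_meet[OF _ M, of "R b"] not_par[OF _ M _ parMM] R in_points[OF M] that
    by (metis IntI)
  \<comment> \<open>The coordinates of \<open>p\<close> are read off where its column meets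
    \<open>L\<close> and its row meets \<open>M\<close>.\<close>
  have surj: "\<exists>a\<in>L. \<exists>b\<in>M. p = g a b" if p: "p \<in> points \<pi>" for p
  proof -
    obtain a where a: "a \<in> L" "a \<in> C p"
      using nonparallel_lines_meet[OF L] not_par[OF L _ parLL] C[OF p] by blast
    obtain b where b: "b \<in> M" "b \<in> R p"
      using nonparallel_lines_meet[OF _ M] not_par[OF _ M _ parMM] R[OF p] by blast
    have "C a = C p" "R b = R p"
      using C_eq R_eq C R p a b in_points L M by metis+
    then have "p \<in> C a" "p \<in> R b" "g a b \<in> C a" "g a b \<in> R b"
      using C R p g a b by auto
    moreover have "\<not> parallel (C a) (R b)"
      using not_par C R a b in_points L M parallel_sym by metis
    ultimately have "p = g a b"
      using nonparallel_lines_meet[of "C a" "R b"] C R a b in_points L M by (metis IntI)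
    then show ?thesis using a b by blast
  qed
  have g_points: "g a b \<in> points \<pi>" if "a \<in> L" "b \<in> M" for a b
    using g C in_points L that by metis
  have col: "a = a'" if "a \<in> L" "a' \<in> L" "b \<in> M" "g a b \<in> C a'" for a a' b
    using that g C_eq C_inj in_points L by metis
  have row: "b = b'" if "b \<in> M" "b' \<in> M" "a \<in> L" "g a b \<in> R b'" for a b b'
    using that g R_eq R_inj in_points M by metis
  have "inj_on f (L \<times> M)"
  proof (rule inj_onI)
    fix x y assume xy: "x \<in> L \<times> M" "y \<in> L \<times> M" "f x = f y"
    obtain a b a' b' where "x = (a, b)" "y = (a', b')" by fastforce
    then show "x = y"
      using xy g col row unfolding f_def by (metis case_prod_conv mem_Sigma_iff)
  qed
  moreover have "f ` (L \<times> M) = points \<pi>"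
    using surj g_points unfolding f_def by fastforce
  ultimately have "bij_betw f (L \<times> M) (points \<pi>)"
    by (simp add: bij_betw_def)
  moreover have "f ` ({a} \<times> M) = C a" if "a \<in> L" for a
  proof -
    have "\<exists>b\<in>M. p = g a b" if "p \<in> C a" for p
      using surj[of p] col that \<open>a \<in> L\<close> C in_points L by metis
    then show ?thesis
      using g that unfolding f_def by fastforce
  qed
  moreover have "f ` (L \<times> {b}) = R b" if "b \<in> M" for b
  proof -
    have "\<exists>a\<in>L. p = g a b" if "p \<in> R b" for p
      using surj[of p] row that \<open>b \<in> M\<close> R in_points M by metis
    then show ?thesis
      using g that unfolding f_def by fastforce
  qed
  ultimately show thesis
    using that C R in_points L M by metis
qed

end

section \<open>Numbers of points and lines\<close>

lemma card_points_affine_plane_of_order: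
  assumes "affine_plane_of_order n \<pi>"
  shows "card (points \<pi>) = n * n"
proof -
  have aff: "affine_plane \<pi>" and card_line: "\<And>l. l \<in> lines \<pi> \<Longrightarrow> card l = n"
    using assms by (auto simp: affine_plane_of_order_def)
  obtain L M where LM: "L \<in> lines \<pi>" "M \<in> lines \<pi>" "\<not> parallel L M"
    by (rule nonparallel_lines_exist[OF aff])
  obtain f where "bij_betw f (L \<times> M) (points \<pi>)"
    by (rule affine_plane_grid[OF aff LM])
  then show ?thesis
    using card_line LM by (metis bij_betw_same_card card_cartesian_product)
qed

text \<open>Two points determine a line, so the 2-subsets of the lines partition the 2-subsets of
  the point set; both sides count these. The product form avoids a division.\<close>

lemma card_lines_affine_plane_of_order:
  assumes "affine_plane_of_order n \<pi>" "n \<ge> 2"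
  shows "finite (lines \<pi>)" "card (lines \<pi>) * (n choose 2) = (n * n) choose 2"
proof -
  have lin: "linear_space \<pi>" and fin: "finite (points \<pi>)"
    and card_line: "\<And>l. l \<in> lines \<pi> \<Longrightarrow> card l = n"
    using assms by (auto simp: affine_plane_of_order_def affine_plane_def)
  have sub: "lines \<pi> \<subseteq> Pow (points \<pi>)"
    using linear_space_line_subset[OF lin] by blast
  then show fin_lines: "finite (lines \<pi>)"
    using fin by (simp add: finite_subset)
  define pairs :: "'a set \<Rightarrow> 'a set set" where "pairs X = {K. K \<subseteq> X \<and> card K = 2}" for X
  have card_pairs: "card (pairs X) = card X choose 2" and fin_pairs: "finite (pairs X)"
    if "X \<subseteq> points \<pi>" for X
    using n_subsets[of X 2] fin that by (auto simp: pairs_def finite_subset)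
  have "pairs (points \<pi>) = (\<Union>l\<in>lines \<pi>. pairs l)"
  proof
    show "pairs (points \<pi>) \<subseteq> (\<Union>l\<in>lines \<pi>. pairs l)"
    proof
      fix K assume K: "K \<in> pairs (points \<pi>)"
      then obtain x y where "K = {x, y}" "x \<noteq> y"
        by (auto simp: pairs_def card_2_iff)
      then show "K \<in> (\<Union>l\<in>lines \<pi>. pairs l)"
        using K linear_space_line_exists[OF lin, of x y] by (auto simp: pairs_def)
    qed
  qed (use sub in \<open>auto simp: pairs_def\<close>)
  moreover have "pairs l \<inter> pairs m = {}" if "l \<in> lines \<pi>" "m \<in> lines \<pi>" "l \<noteq> m" for l m
    using linear_space_line_eq[OF lin that(1,2)] that(3) by (auto simp: pairs_def card_2_iff)
  moreover have "finite (pairs l)" if "l \<in> lines \<pi>" for l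
    using fin_pairs sub that by blast
  ultimately have "card (pairs (points \<pi>)) = (\<Sum>l\<in>lines \<pi>. card (pairs l))"
    by (simp add: card_UN_disjoint fin_lines)
  also have "\<dots> = (\<Sum>l\<in>lines \<pi>. n choose 2)"
    using sub by (intro sum.cong) (auto simp: card_pairs card_line)
  finally show "card (lines \<pi>) * (n choose 2) = (n * n) choose 2"
    using card_points_affine_plane_of_order[OF assms(1)] by (simp add: card_pairs)
qed

corollary card_lines_affine_plane_of_order_3:
  assumes "affine_plane_of_order 3 \<pi>"
  shows "card (lines \<pi>) = 12"
proof -
  have "(3::nat) choose 2 = 3" "(9::nat) choose 2 = 36"
    by (simp_all add: choose_two)
  then show ?thesis
    using card_lines_affine_plane_of_order(2)[OF assms] by simp
qed

section \<open>Uniqueness of the affine plane of order 3\<close>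

lemma UNIV_3: "(UNIV :: 3 set) = {0, 1, 2}"
proof -
  have "card {0, 1, 2 :: 3} = CARD(3)" by simp
  then show ?thesis by (metis card_subset_eq finite subset_UNIV)
qed

lemma forall_3: "(\<forall>x :: 3. P x) \<longleftrightarrow> P 0 \<and> P 1 \<and> P 2"
  by (metis (mono_tags) UNIV_3 UNIV_I insertE singletonD)

text \<open>Each nonzero residue is its own inverse, which lets multiplication do the work of
  division below.\<close>

lemma square_eq_1_3: "x \<noteq> 0 \<Longrightarrow> x * x = (1 :: 3)"
  using forall_3[of "\<lambda>x. x \<noteq> 0 \<longrightarrow> x * x = 1"] by simp

text \<open>The line \<open>m\<close> through the cells in columns 0 and 1 is neither a row nor a
  column, so no two of its points share a row or a column. This forces its third point into column 2
  and the one row left, which is \<open>g 2\<close>.\<close>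

lemma transversal_line:
  fixes f :: "3 \<times> 3 \<Rightarrow> 'a" and g :: "3 \<Rightarrow> 3"
  assumes lin: "linear_space \<pi>" and card_line: "\<And>l. l \<in> lines \<pi> \<Longrightarrow> card l = 3"
    and bij: "bij_betw f UNIV (points \<pi>)"
    and col: "\<And>x. f ` ({x} \<times> UNIV) \<in> lines \<pi>" and row: "\<And>y. f ` (UNIV \<times> {y}) \<in> lines \<pi>"
    and g: "inj g"
  shows "f ` range (\<lambda>x. (x, g x)) \<in> lines \<pi>"
proof -
  have f_inj: "f p = f q \<longleftrightarrow> p = q" for p q
    using bij by (metis bij_betw_def inj_eq)
  have f_points: "f p \<in> points \<pi>" for p
    using bij by (auto simp: bij_betw_def)
  have f_mem: "f p \<in> f ` X \<longleftrightarrow> p \<in> X" for p X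
    using f_inj by (metis imageE imageI)
  have g_ne: "g 0 \<noteq> g 1" "g 0 \<noteq> g 2" "g 1 \<noteq> g 2"
    using g by (simp_all add: inj_eq)
  obtain m where m: "m \<in> lines \<pi>" "f (0, g 0) \<in> m" "f (1, g 1) \<in> m"
    using linear_space_line_exists[OF lin, of "f (0, g 0)" "f (1, g 1)"] f_points f_inj
    by (metis Pair_inject zero_neq_one)
  have same_col: "m = f ` ({x} \<times> UNIV)" if "f (x, y) \<in> m" "f (x, z) \<in> m" "y \<noteq> z" for x y z
    using linear_space_line_eq[OF lin m(1) col that(1,2), of x] that(3)
    by (simp add: f_mem f_inj)
  have same_row: "m = f ` (UNIV \<times> {y})" if "f (x, y) \<in> m" "f (z, y) \<in> m" "x \<noteq> z" for x y z
    using linear_space_line_eq[OF lin m(1) row that(1,2), of y] that(3)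
    by (simp add: f_mem f_inj)
  obtain w where w: "m = {f (0, g 0), f (1, g 1), w}" "w \<noteq> f (0, g 0)" "w \<noteq> f (1, g 1)"
  proof -
    have "card (m - {f (0, g 0), f (1, g 1)}) = 1"
      using m card_line[OF m(1)] by (simp add: card_Diff_subset f_inj)
    then obtain w where "m - {f (0, g 0), f (1, g 1)} = {w}"
      by (auto simp: card_1_singleton_iff)
    then show thesis
      using that m by blast
  qed
  have "w \<in> points \<pi>"
    using w m linear_space_line_subset[OF lin] by blast
  then obtain x y where xy: "w = f (x, y)"
    using bij by (metis bij_betw_def imageE surj_pair)
  have w_in: "f (x, y) \<in> m"
    using w xy by blast
  \<comment> \<open>The two cells that define \<open>m\<close> lie in different columns and in
    different rows.\<close>
  have not_col: "m \<noteq> f ` ({z} \<times> UNIV)" for z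
    using m f_mem[of "(0, g 0)" "{z} \<times> UNIV"] f_mem[of "(1, g 1)" "{z} \<times> UNIV"] by auto
  have not_row: "m \<noteq> f ` (UNIV \<times> {z})" for z
    using m f_mem[of "(0, g 0)" "UNIV \<times> {z}"] f_mem[of "(1, g 1)" "UNIV \<times> {z}"] g_ne by auto
  have "x \<noteq> 0" "x \<noteq> 1"
    using same_col[of 0 "g 0" y] same_col[of 1 "g 1" y] m not_col w_in w xy by metis+
  then have "x = 2"
    using forall_3[of "\<lambda>x. x \<noteq> 0 \<longrightarrow> x \<noteq> 1 \<longrightarrow> x = 2"] by simp
  have "y \<noteq> g 0" "y \<noteq> g 1"
    using same_row[of 0 "g 0" x] same_row[of 1 "g 1" x] m not_row w_in w xy by metis+
  moreover have "range g = UNIV"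
    using g by (simp add: finite_UNIV_inj_surj)
  ultimately have "y = g 2"
    by (metis UNIV_3 UNIV_I imageE image_insert image_empty insertE singletonD)
  then have "m = f ` {(0, g 0), (1, g 1), (2, g 2)}"
    using w xy \<open>x = 2\<close> by auto
  also have "{(0, g 0), (1, g 1), (2, g 2)} = range (\<lambda>x. (x, g x))"
    by (simp add: UNIV_3)
  finally show ?thesis
    using m by simp
qed

text \<open>These are the shapes that the grid of an arbitrary plane provides: columns, rows and
  transversals. A line with both coefficients nonzero is the graph of a function of nonzero slope,
  hence of an injection.\<close>

lemma AG_2_3_line_cases:
  assumes "l \<in> lines AG_2_3"
  obtains x where "l = {x} \<times> UNIV"
  | y where "l = UNIV \<times> {y}"
  | g where "inj g" "l = range (\<lambda>x. (x, g x))"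
proof -
  obtain a b c where l: "l = {(x, y). a * x + b * y = c}" and ab: "(a, b) \<noteq> (0, 0)"
    using assms by (auto simp: AG_2_3_def)
  have solve: "d * z = e \<longleftrightarrow> z = d * e" if "d \<noteq> 0" for d z e :: 3
    using square_eq_1_3[OF that] by (metis mult.assoc mult_1)
  consider "b = 0" "a \<noteq> 0" | "a = 0" "b \<noteq> 0" | "a \<noteq> 0" "b \<noteq> 0"
    using ab by auto
  then show thesis
  proof cases
    case 1
    then have "l = {a * c} \<times> UNIV" by (auto simp: l solve)
    then show thesis by (rule that(1))
  next
    case 2
    then have "l = UNIV \<times> {b * c}" by (auto simp: l solve)
    then show thesis by (rule that(2))
  next
    case 3
    define g where "g x = b * (c - a * x)" for x
    have "a * x + b * y = c \<longleftrightarrow> y = g x" for x y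
      using solve[OF 3(2), of y "c - a * x"] by (auto simp: g_def algebra_simps)
    then have "l = range (\<lambda>x. (x, g x))"
      by (auto simp: l)
    moreover have "inj g"
    proof (rule injI)
      fix x y assume "g x = g y"
      then have "b * (c - a * x) = b * (c - a * y)" by (simp add: g_def)
      then have "a * x = a * y"
        using solve[OF 3(2)] square_eq_1_3[OF 3(2)]
        by (metis add_diff_cancel_left' diff_add_cancel mult.assoc mult_1)
      then show "x = y"
        using square_eq_1_3[OF 3(1)] by (metis mult.assoc mult_1)
    qed
    ultimately show thesis by (rule that(3)[rotated])
  qed
qed

lemma AG_2_3_line_exists:
  assumes "p \<noteq> q"
  shows "\<exists>l\<in>lines AG_2_3. p \<in> l \<and> q \<in> l"
proof -
  obtain x y x' y' where pq: "p = (x, y)" "q = (x', y')" by fastforce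
  \<comment> \<open>The coefficient vector is orthogonal to the direction
    \<open>(x' - x, y' - y)\<close>, and the constant makes the line pass through
    \<open>p\<close>.\<close>
  define l where "l = {(u, v). (y - y') * u + (x' - x) * v = (y - y') * x + (x' - x) * y}"
  have "(y - y', x' - x) \<noteq> (0, 0)"
    using assms pq by auto
  then have "l \<in> lines AG_2_3"
    unfolding AG_2_3_def l_def snd_conv by blast
  moreover have "p \<in> l" "q \<in> l"
    by (simp_all add: l_def pq algebra_simps)
  ultimately show ?thesis by blast
qed

theorem affine_plane_of_order_3_isomorphic_AG_2_3:
  assumes "affine_plane_of_order 3 \<pi>"
  shows "isomorphic_planes \<pi> AG_2_3"
proof -
  have aff: "affine_plane \<pi>" and card_line: "\<And>l. l \<in> lines \<pi> \<Longrightarrow> card l = 3"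
    using assms by (auto simp: affine_plane_of_order_def)
  note lin = linear[OF aff]
  obtain L M where LM: "L \<in> lines \<pi>" "M \<in> lines \<pi>" "\<not> parallel L M"
    by (rule nonparallel_lines_exist[OF aff])
  obtain h where h: "bij_betw h (L \<times> M) (points \<pi>)"
    "\<And>a. a \<in> L \<Longrightarrow> h ` ({a} \<times> M) \<in> lines \<pi>" "\<And>b. b \<in> M \<Longrightarrow> h ` (L \<times> {b}) \<in> lines \<pi>"
    using affine_plane_grid[OF aff LM] by metis
  have fin: "finite L" "finite M"
    using card_line LM by (auto intro: card_ge_0_finite)
  \<comment> \<open>Any labelling of \<open>L\<close> and \<open>M\<close> by residues will do,
    because all six transversals of the grid are lines.\<close>
  obtain u where u: "bij_betw u (UNIV :: 3 set) L"
    using finite_same_card_bij[of "UNIV :: 3 set" L] fin card_line[OF LM(1)] by auto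
  obtain v where v: "bij_betw v (UNIV :: 3 set) M"
    using finite_same_card_bij[of "UNIV :: 3 set" M] fin card_line[OF LM(2)] by auto
  define f where "f = h \<circ> map_prod u v"
  have bij: "bij_betw f UNIV (points \<pi>)"
    unfolding f_def using bij_betw_map_prod[OF u v] h(1) by (auto intro: bij_betw_trans)
  have ran: "range u = L" "range v = M"
    using u v by (auto simp: bij_betw_def)
  have col: "f ` ({x} \<times> UNIV) \<in> lines \<pi>" for x
  proof -
    have "f ` ({x} \<times> UNIV) = h ` ({u x} \<times> M)"
      unfolding f_def image_comp[symmetric]
      by (subst map_prod_surj_on[of u "{x}" "{u x}" v UNIV M]) (simp_all add: ran)
    then show ?thesis using h ran by auto
  qed
  have row: "f ` (UNIV \<times> {y}) \<in> lines \<pi>" for y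
  proof -
    have "f ` (UNIV \<times> {y}) = h ` (L \<times> {v y})"
      unfolding f_def image_comp[symmetric]
      by (subst map_prod_surj_on[of u UNIV L v "{y}" "{v y}"]) (simp_all add: ran)
    then show ?thesis using h ran by auto
  qed
  have image_line: "f ` l \<in> lines \<pi>" if "l \<in> lines AG_2_3" for l
    using AG_2_3_line_cases[OF that] col row transversal_line[OF lin card_line bij col row] by metis
  \<comment> \<open>Two points of \<open>m\<close> come from two points of \<open>AG_2_3\<close>.
    The line joining those is mapped to a line of the plane that shares two points with
    \<open>m\<close>, hence to \<open>m\<close> itself.\<close>
  have "lines \<pi> \<subseteq> (\<lambda>l. f ` l) ` lines AG_2_3"
  proof
    fix m assume m: "m \<in> lines \<pi>"
    then obtain a b c where abc: "m = {a, b, c}" "a \<noteq> b"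
      using card_line[OF m] by (auto simp: card_3_iff)
    have "m \<subseteq> points \<pi>"
      using m linear_space_line_subset[OF lin] by blast
    then obtain p q where pq: "a = f p" "b = f q"
      using abc bij by (metis bij_betw_def imageE insert_subset)
    then obtain l where l: "l \<in> lines AG_2_3" "p \<in> l" "q \<in> l"
      using AG_2_3_line_exists[of p q] abc by auto
    then have "m = f ` l"
      using linear_space_line_eq[OF lin m image_line[OF l(1)], of a b] abc pq by auto
    then show "m \<in> (\<lambda>l. f ` l) ` lines AG_2_3"
      using l by blast
  qed
  then have lines_eq: "lines \<pi> = (\<lambda>l. f ` l) ` lines AG_2_3"
    using image_line by blast
  define f' where "f' = inv_into UNIV f"
  have "bij_betw f' (points \<pi>) (points AG_2_3)"
    using bij_betw_inv_into[OF bij] by (simp add: f'_def AG_2_3_def)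
  moreover have "f' ` f ` l = l" for l
    using bij by (simp add: f'_def bij_betw_def inv_into_image_cancel)
  then have "(\<lambda>l. f' ` l) ` lines \<pi> = lines AG_2_3"
    by (simp add: lines_eq image_image)
  ultimately show ?thesis
    unfolding isomorphic_planes_def by blast
qed

section \<open>Upper bound\<close>

text \<open>A common line would meet itself in three points.\<close>

lemma orthogoval_lines_disjoint:
  assumes "orthogoval \<pi> \<sigma>" "\<And>l. l \<in> lines \<pi> \<Longrightarrow> card l = 3"
  shows "lines \<pi> \<inter> lines \<sigma> = {}"
proof (rule ccontr)
  assume "lines \<pi> \<inter> lines \<sigma> \<noteq> {}"
  then obtain l where "l \<in> lines \<pi>" "l \<in> lines \<sigma>" by blast
  then show False
    using assms unfolding orthogoval_def by fastforce
qed

lemma card_mutually_orthogoval_affine_planes_3: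
  assumes "mutually_orthogoval_affine_planes 3 P S"
  shows "finite S" "card S \<le> 7"
proof -
  have plane: "affine_plane_of_order 3 \<pi>" "points \<pi> = P" if "\<pi> \<in> S" for \<pi>
    using assms that by (auto simp: mutually_orthogoval_affine_planes_def)
  have orth: "orthogoval \<pi> \<sigma>" if "\<pi> \<in> S" "\<sigma> \<in> S" "\<pi> \<noteq> \<sigma>" for \<pi> \<sigma>
    using assms that by (auto simp: mutually_orthogoval_affine_planes_def pairwise_def)
  have "finite S \<and> card S \<le> 7"
  \<comment> \<open>Only a member of \<open>S\<close> yields that \<open>P\<close> is finite with
    nine points; the empty set says nothing about \<open>P\<close>.\<close>
  proof (cases "S = {}")
    case False
    then obtain \<pi> where "\<pi> \<in> S" by blast
    then have finP: "finite P" and cardP: "card P = 9"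
      using plane[of \<pi>] card_points_affine_plane_of_order[of 3 \<pi>]
      by (auto simp: affine_plane_of_order_def)
    have line: "l \<subseteq> P" "card l = 3" if "\<pi> \<in> S" "l \<in> lines \<pi>" for \<pi> l
      using plane[OF that(1)] that(2)
      by (auto simp: affine_plane_of_order_def affine_plane_def dest: linear_space_line_subset)
    have "S \<subseteq> {P} \<times> Pow (Pow P)"
    proof
      fix \<pi> assume "\<pi> \<in> S"
      then show "\<pi> \<in> {P} \<times> Pow (Pow P)"
        using plane(2)[of \<pi>] line(1)[of \<pi>] by (cases \<pi>) auto
    qed
    then have finS: "finite S"
      by (rule finite_subset) (simp add: finP)
    have "lines \<pi> \<inter> lines \<sigma> = {}" if "\<pi> \<in> S" "\<sigma> \<in> S" "\<pi> \<noteq> \<sigma>" for \<pi> \<sigma>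
      using orthogoval_lines_disjoint[OF orth[OF that]] line that by blast
    moreover have "finite (lines \<pi>)" if "\<pi> \<in> S" for \<pi>
      using card_lines_affine_plane_of_order(1)[OF plane(1)[OF that]] by simp
    ultimately have "card (\<Union>\<pi>\<in>S. lines \<pi>) = (\<Sum>\<pi>\<in>S. card (lines \<pi>))"
      using finS by (intro card_UN_disjoint) auto
    then have "12 * card S = card (\<Union>\<pi>\<in>S. lines \<pi>)"
      by (simp add: plane card_lines_affine_plane_of_order_3)
    also have "\<dots> \<le> card {K. K \<subseteq> P \<and> card K = 3}"
      using line finP by (intro card_mono) auto
    also have "\<dots> = 9 choose 3"
      using n_subsets[OF finP] cardP by simp
    also have "(9 choose 3 :: nat) = 84"
      by code_simp
    finally show ?thesis
      using finS by simp
  qed simp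
  then show "finite S" "card S \<le> 7" by auto
qed

section \<open>Seven translates of an affine plane\<close>

definition map_plane :: "('a \<Rightarrow> 'b) \<Rightarrow> 'a plane \<Rightarrow> 'b plane" where
  "map_plane f \<pi> = (f ` points \<pi>, (\<lambda>l. f ` l) ` lines \<pi>)"

lemma points_map_plane [simp]: "points (map_plane f \<pi>) = f ` points \<pi>"
  and lines_map_plane [simp]: "lines (map_plane f \<pi>) = (\<lambda>l. f ` l) ` lines \<pi>"
  by (simp_all add: map_plane_def)

lemma map_plane_comp: "map_plane f (map_plane g \<pi>) = map_plane (f \<circ> g) \<pi>"
  by (simp add: map_plane_def image_comp image_image comp_def)

lemma affine_plane_of_order_line_subset:
  "affine_plane_of_order n \<pi> \<Longrightarrow> l \<in> lines \<pi> \<Longrightarrow> l \<subseteq> points \<pi>"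
  by (auto simp: affine_plane_of_order_def affine_plane_def dest: linear_space_line_subset)

text \<open>Carries the unique existence of a joining line or of a parallel over to the image plane:
  every solution there is the image of a solution in \<open>A\<close>, and that one is
  unique.\<close>

lemma Ex1_image:
  assumes "\<exists>!x. x \<in> A \<and> P x" "\<And>x. x \<in> A \<Longrightarrow> Q (f x) \<longleftrightarrow> P x"
  shows "\<exists>!y. y \<in> f ` A \<and> Q y"
  using assms by blast

text \<open>Injectivity on the points preserves and reflects both incidence and disjointness of
  lines (\<open>mem\<close> and \<open>disj\<close>), in terms of which the axioms are
  phrased.\<close>

lemma affine_plane_of_order_map_plane:
  assumes pl: "affine_plane_of_order n \<pi>" and inj: "inj_on f (points \<pi>)"
  shows "affine_plane_of_order n (map_plane f \<pi>)"
proof -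
  have aff: "affine_plane \<pi>" and lin: "linear_space \<pi>"
    using pl by (auto simp: affine_plane_of_order_def affine_plane_def)
  note sub = affine_plane_of_order_line_subset[OF pl]
  have mem: "f p \<in> f ` l \<longleftrightarrow> p \<in> l" if "l \<in> lines \<pi>" "p \<in> points \<pi>" for l p
    using inj sub that by (meson inj_on_image_mem_iff)
  have disj: "f ` l \<inter> f ` m = {} \<longleftrightarrow> l \<inter> m = {}" if "l \<in> lines \<pi>" "m \<in> lines \<pi>" for l m
    using inj_on_image_Int[OF inj sub sub, OF that] by auto
  have "linear_space (map_plane f \<pi>)"
    unfolding linear_space_def
  proof (intro conjI ballI impI)
    fix p q assume "p \<in> points (map_plane f \<pi>)" "q \<in> points (map_plane f \<pi>)" "p \<noteq> q"
    then obtain x y where xy: "p = f x" "q = f y" "x \<in> points \<pi>" "y \<in> points \<pi>" "x \<noteq> y"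
      by auto
    then have "\<exists>!l. l \<in> lines \<pi> \<and> x \<in> l \<and> y \<in> l"
      using lin by (simp add: linear_space_def)
    then show "\<exists>!l. l \<in> lines (map_plane f \<pi>) \<and> p \<in> l \<and> q \<in> l"
      unfolding lines_map_plane by (rule Ex1_image) (simp add: mem xy)
  qed (use sub in auto)
  moreover have "\<exists>!m. m \<in> lines (map_plane f \<pi>) \<and> p \<in> m \<and> l \<inter> m = {}"
    if lp: "l \<in> lines (map_plane f \<pi>)" "p \<in> points (map_plane f \<pi>)" "p \<notin> l" for l p
  proof -
    obtain k x where kx: "l = f ` k" "k \<in> lines \<pi>" "p = f x" "x \<in> points \<pi>"
      using lp by auto
    then have "x \<notin> k"
      using lp(3) by blast
    moreover have "\<forall>l\<in>lines \<pi>. \<forall>p\<in>points \<pi>. p \<notin> l \<longrightarrow>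
        (\<exists>!m. m \<in> lines \<pi> \<and> p \<in> m \<and> l \<inter> m = {})"
      using aff by (simp add: affine_plane_def)
    ultimately have "\<exists>!m. m \<in> lines \<pi> \<and> x \<in> m \<and> k \<inter> m = {}"
      using kx by simp
    then show ?thesis
      unfolding lines_map_plane by (rule Ex1_image) (simp add: mem disj kx)
  qed
  moreover have "\<exists>X\<subseteq>points (map_plane f \<pi>). card X = 3 \<and> \<not> collinear_in (map_plane f \<pi>) X"
  proof -
    obtain X where X: "X \<subseteq> points \<pi>" "card X = 3" "\<not> collinear_in \<pi> X"
      using aff by (auto simp: affine_plane_def)
    have "\<not> f ` X \<subseteq> f ` l" if "l \<in> lines \<pi>" for l
    proof
      assume "f ` X \<subseteq> f ` l"
      then have "X \<subseteq> l"
        using mem[OF that] X(1) by blast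
      then show False
        using X(3) that by (auto simp: collinear_in_def)
    qed
    then have "\<not> collinear_in (map_plane f \<pi>) (f ` X)"
      by (auto simp: collinear_in_def)
    moreover have "card (f ` X) = 3"
      using X inj by (metis card_image inj_on_subset)
    ultimately show ?thesis
      using X by (intro exI[of _ "f ` X"]) auto
  qed
  moreover have "card (f ` l) = n" if "l \<in> lines \<pi>" for l
    using pl card_image[OF inj_on_subset[OF inj sub[OF that]]] that
    by (simp add: affine_plane_of_order_def)
  ultimately show ?thesis
    using pl unfolding affine_plane_of_order_def affine_plane_def by auto
qed

text \<open>Serves twice: with a shift, to reduce a pair of translates to one containing the base
  plane, and with a bijection onto \<open>P\<close>, to leave the natural numbers.\<close>

lemma orthogoval_map_plane:
  assumes pl: "affine_plane_of_order n \<pi>" "affine_plane_of_order n \<sigma>"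
    and orth: "orthogoval \<pi> \<sigma>" and inj: "inj_on f (points \<pi>)"
  shows "orthogoval (map_plane f \<pi>) (map_plane f \<sigma>)"
proof -
  have pts: "points \<pi> = points \<sigma>"
    using orth by (simp add: orthogoval_def)
  have "card (f ` l \<inter> f ` m) \<le> 2" if lm: "l \<in> lines \<pi>" "m \<in> lines \<sigma>" for l m
  proof -
    have sub: "l \<subseteq> points \<pi>" "m \<subseteq> points \<pi>"
      using lm affine_plane_of_order_line_subset pl pts by metis+
    then have "card (f ` l \<inter> f ` m) = card (l \<inter> m)"
      using inj_on_image_Int[OF inj sub] inj
      by (metis card_image inf.coboundedI1 inj_on_subset)
    then show ?thesis
      using orth lm by (simp add: orthogoval_def)
  qed
  moreover have "affine_plane_of_order n (map_plane f \<pi>)" "affine_plane_of_order n (map_plane f \<sigma>)"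
    using pl affine_plane_of_order_map_plane inj pts by metis+
  ultimately show ?thesis
    using pts by (auto simp: orthogoval_def)
qed

lemma orthogoval_sym: "orthogoval \<pi> \<sigma> \<Longrightarrow> orthogoval \<sigma> \<pi>"
  unfolding orthogoval_def by (metis Int_commute)

text \<open>Here 0 to 6 stand for the residues modulo 7, and 7 and 8 for the two further points.
  Each orbit of triples has one representative: five within the residues, with cyclic gaps (1,1,5),
  (1,2,4), (1,4,2), (1,3,3) and (2,2,3); three with 7 and three with 8, whose residues differ by 1,
  2 or 3 up to sign; and one with both. Explicit lists let evaluation decide the axioms.\<close>

definition base_lines :: "nat set set" where
  "base_lines = set (map set [[0,1,2],[0,3,7],[0,4,6],[0,5,8],[1,3,6],[1,4,5],
     [1,7,8],[2,3,5],[2,4,7],[2,6,8],[3,4,8],[5,6,7]])"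

definition base_plane :: "nat plane" where
  "base_plane = ({0..<9}, base_lines)"

definition shift :: "nat \<Rightarrow> nat \<Rightarrow> nat" where
  "shift k x = (if x < 7 then (x + k) mod 7 else x)"

text \<open>Rewrites unique existence with bounded quantifiers, which can be evaluated over an
  explicit finite set.\<close>

lemma Ex1_iff_bex: "(\<exists>!x. x \<in> A \<and> P x) \<longleftrightarrow> (\<exists>x\<in>A. P x \<and> (\<forall>y\<in>A. P y \<longrightarrow> y = x))"
  by blast

lemma affine_plane_base_plane: "affine_plane_of_order 3 base_plane"
proof -
  have "\<forall>l\<in>base_lines. card l = 3 \<and> l \<subseteq> {0..<9}"
    unfolding base_lines_def by code_simp
  moreover have "\<forall>p\<in>{0..<9}. \<forall>q\<in>{0..<9}. p \<noteq> q \<longrightarrow>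
      (\<exists>l\<in>base_lines. (p \<in> l \<and> q \<in> l) \<and> (\<forall>m\<in>base_lines. p \<in> m \<and> q \<in> m \<longrightarrow> m = l))"
    unfolding base_lines_def by code_simp
  moreover have "\<forall>l\<in>base_lines. \<forall>p\<in>{0..<9}. p \<notin> l \<longrightarrow>
      (\<exists>m\<in>base_lines. (p \<in> m \<and> l \<inter> m = {}) \<and>
        (\<forall>n\<in>base_lines. p \<in> n \<and> l \<inter> n = {} \<longrightarrow> n = m))"
    unfolding base_lines_def by code_simp
  \<comment> \<open>The only line through 0 and 1 has third point 2, so 0, 1, 3 form a
    triangle.\<close>
  moreover have "\<forall>l\<in>base_lines. \<not> {0, 1, 3} \<subseteq> l"
    unfolding base_lines_def by code_simp
  then have "\<exists>X\<subseteq>{0..<9}. card X = 3 \<and> \<not> collinear_in base_plane X"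
    by (intro exI[of _ "{0, 1, 3}"]) (simp add: collinear_in_def base_plane_def)
  ultimately show ?thesis
    unfolding affine_plane_of_order_def affine_plane_def linear_space_def Ex1_iff_bex
    by (simp add: base_plane_def)
qed

lemma shift_image: "shift k ` {0..<9} = {0..<9}" and inj_on_shift: "inj_on (shift k) {0..<9}"
proof -
  have "inj_on (shift k) {0..<9}"
  proof (rule inj_onI)
    fix x y assume xy: "x \<in> {0..<9}" "y \<in> {0..<9}" "shift k x = shift k y"
    have lt: "(z + k) mod 7 < 7" for z by simp
    show "x = y"
    proof (cases "x < 7 \<and> y < 7")
      case True
      then have "(x + k) mod 7 = (y + k) mod 7"
        using xy by (simp add: shift_def)
      \<comment> \<open>The integers give a true difference of \<open>x\<close> and
        \<open>y\<close>. It is divisible by 7 and lies strictly between -7 and 7, so it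
        vanishes.\<close>
      then have "(int x + int k) mod 7 = (int y + int k) mod 7"
        by (metis of_nat_add of_nat_mod of_nat_numeral)
      then have "7 dvd int x - int y"
        by (simp add: mod_eq_dvd_iff)
      then show ?thesis
        using True by presburger
    next
      \<comment> \<open>Residues stay below 7, while 7 and 8 are fixed, so the two kinds of points
        cannot collide.\<close>
      case False
      then show ?thesis
        using xy lt[of x] lt[of y] by (auto simp: shift_def split: if_splits)
    qed
  qed
  then show "inj_on (shift k) {0..<9}" .
  moreover have "shift k ` {0..<9} \<subseteq> {0..<9}"
    using mod_less_divisor[of 7] by (auto simp: shift_def intro: less_trans)
  ultimately show "shift k ` {0..<9} = {0..<9}"
    by (simp add: endo_inj_surj)
qed

lemma affine_plane_shift_base_plane: "affine_plane_of_order 3 (map_plane (shift k) base_plane)"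
  by (rule affine_plane_of_order_map_plane[OF affine_plane_base_plane])
    (simp add: base_plane_def inj_on_shift)

text \<open>The base lines represent different orbits, and a nontrivial translation fixes no triple.
  So no base line equals a shifted one, and distinct triples share at most two points. The proof
  checks all the intersections by evaluation.\<close>

lemma orthogoval_shift_base_plane:
  assumes "0 < d" "d < 7"
  shows "orthogoval base_plane (map_plane (shift d) base_plane)"
proof -
  have "\<forall>d\<in>{1..<7}. \<forall>l\<in>base_lines. \<forall>m\<in>base_lines. card (l \<inter> shift d ` m) \<le> 2"
    unfolding base_lines_def by code_simp
  then have "\<forall>l\<in>base_lines. \<forall>m\<in>base_lines. card (l \<inter> shift d ` m) \<le> 2"
    using assms by simp
  then show ?thesis
    using affine_plane_base_plane affine_plane_shift_base_plane[of d]
    by (auto simp: orthogoval_def base_plane_def shift_image)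
qed

lemma map_plane_shift_shift:
  "map_plane (shift i) (map_plane (shift j) base_plane) = map_plane (shift (i + j)) base_plane"
proof -
  \<comment> \<open>The sum \<open>i + j\<close> may exceed 6; \<open>shift\<close> reduces modulo 7
    by itself.\<close>
  have "(shift i \<circ> shift j) x = shift (i + j) x" for x
    by (simp add: shift_def mod_add_left_eq mod_add_right_eq ac_simps)
  then show ?thesis
    unfolding map_plane_comp by (metis ext)
qed

lemma seven_mutually_orthogoval_affine_planes:
  assumes "card P = 9"
  shows "\<exists>S. mutually_orthogoval_affine_planes 3 P S \<and> card S = 7"
proof -
  define B where "B k = map_plane (shift k) base_plane" for k
  have ptsB: "points (B k) = {0..<9}" for k
    by (simp add: B_def base_plane_def shift_image)
  have planeB: "affine_plane_of_order 3 (B k)" for k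
    by (simp add: B_def affine_plane_shift_base_plane)
  \<comment> \<open>Undoing the shift by \<open>i\<close> leaves the base plane and its translate by
    \<open>j - i\<close>, which lies between 1 and 6. Symmetry then handles
    \<open>j < i\<close>.\<close>
  have orthB_less: "orthogoval (B i) (B j)" if "i < j" "j < 7" for i j
  proof -
    have "orthogoval (map_plane (shift i) base_plane) (map_plane (shift i) (B (j - i)))"
      unfolding B_def using that
      by (intro orthogoval_map_plane[OF affine_plane_base_plane planeB[unfolded B_def]]
          orthogoval_shift_base_plane) (simp_all add: base_plane_def inj_on_shift)
    then show ?thesis
      using that by (simp add: B_def map_plane_shift_shift)
  qed
  have orthB: "orthogoval (B i) (B j)" if "i < 7" "j < 7" "i \<noteq> j" for i j
    using orthB_less orthogoval_sym that by (metis linorder_neqE_nat)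
  \<comment> \<open>An infinite set would have cardinality 0.\<close>
  have "finite P"
    using assms by (simp add: card_ge_0_finite)
  then obtain f where f: "bij_betw f {0..<9::nat} P"
    using ex_bij_betw_nat_finite[of P] assms by auto
  then have inj: "inj_on f {0..<9}" and img: "f ` {0..<9} = P"
    by (auto simp: bij_betw_def)
  define Q where "Q k = map_plane f (B k)" for k
  have planeQ: "affine_plane_of_order 3 (Q k)" "points (Q k) = P" for k
    using affine_plane_of_order_map_plane[OF planeB] inj ptsB img by (simp_all add: Q_def)
  have orthQ: "orthogoval (Q i) (Q j)" if "i < 7" "j < 7" "i \<noteq> j" for i j
    using orthogoval_map_plane[OF planeB planeB orthB[OF that]] inj ptsB by (simp add: Q_def)
  \<comment> \<open>Orthogovality was shown for distinct indices, so coinciding planes must still be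
    excluded: such a plane would be orthogoval to itself, its line set disjoint from itself and thus
    empty, yet it has 12 lines.\<close>
  have "inj_on Q {..<7}"
  proof (rule inj_onI, rule ccontr)
    fix i j :: nat assume ij: "i \<in> {..<7}" "j \<in> {..<7}" "Q i = Q j" "i \<noteq> j"
    then have "lines (Q i) \<inter> lines (Q j) = {}"
      using orthogoval_lines_disjoint[OF orthQ, of i j] planeQ(1)[of i]
      by (simp add: affine_plane_of_order_def)
    then show False
      using ij card_lines_affine_plane_of_order_3[OF planeQ(1), of i] by simp
  qed
  then have "card (Q ` {..<7}) = 7"
    by (simp add: card_image)
  moreover have "mutually_orthogoval_affine_planes 3 P (Q ` {..<7})"
    unfolding mutually_orthogoval_affine_planes_def pairwise_def
    using planeQ by (auto intro!: orthQ)
  ultimately show ?thesis by blast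
qed

text \<open>The bound includes \<open>finite S\<close> because infinite sets have cardinality 0.
  Attainment is claimed on every nine-element set of the type, so the second part is vacuous for
  types with fewer than nine elements.\<close>

theorem theorem3p1:
  "(\<forall>(P :: 'a set) S. mutually_orthogoval_affine_planes 3 P S \<longrightarrow>
      finite S \<and> card S \<le> 7 \<and> (\<forall>\<pi>\<in>S. isomorphic_planes \<pi> AG_2_3)) \<and>
   (\<forall>P :: 'a set. card P = 9 \<longrightarrow>
      (\<exists>S. mutually_orthogoval_affine_planes 3 P S \<and> card S = 7))"
proof (intro conjI allI impI ballI)
  fix P :: "'a set" and S :: "'a plane set" and \<pi>
  assume S: "mutually_orthogoval_affine_planes 3 P S"
  show "finite S" "card S \<le> 7"
    using card_mutually_orthogoval_affine_planes_3[OF S] by auto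
  assume "\<pi> \<in> S"
  then show "isomorphic_planes \<pi> AG_2_3"
    using S affine_plane_of_order_3_isomorphic_AG_2_3
    unfolding mutually_orthogoval_affine_planes_def by blast
qed (rule seven_mutually_orthogoval_affine_planes)

end
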